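(* Let $\mathbb{F}_{q^l}$ be a subfield of $\mathbb{F}_{q^m}$. Let $f_1,\dots,f_s\in\mathbb{F}_{q^l}\langle X^q\rangle$ have $q$-degrees $d_1,\dots,d_s$, let $n=\sum_i d_i$, and assume that each $f_i$ is coprime with the left least common multiple $b_i$ of the $f_j$, $j\ne i$. Let $k<n$ be a positive integer and let $A\in\mathbb{F}_{q^m}\langle X^q\rangle$ have $q$-degree $\alpha$ with $k+\alpha<n$. Let $r\in\left\{1,\dots,\min\left(\left\lfloor\frac{m}{l}\right\rfloor,\left\lfloor\frac{n-\alpha-k}{l}\right\rfloor\right)\right\}$. Assume that $e$ follows a uniform distribution on $\mathbb{F}_{q^m}^n$, and let $E=\Phi(e)$, with upper part $\overline{E}$. Then, knowing that $w_r(E)\le r\cdot l$, the equality $\overline{\mathcal{E}}=\mathcal{E}$ of the supports of $\overline{E}$ and $E$ holds with probability bounded by $$q^{l\cdot r\cdot(k+\alpha)}\prod_{i=0}^{r\cdot l-1}\frac{q^{n-(k+\alpha)}-q^i}{q^n-q^i}.$$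
   Context: Let $q$ be a prime power and $m$ a positive integer. $\mathbb{F}_{q^m}\langle X^q\rangle$ is the set of linearized polynomials $\sum_{i=0}^{t} p_iX^{q^i}$, $p_i\in\mathbb{F}_{q^m}$, a non-commutative ring under addition and composition $\circ$, determined by $(aX^{q^i})\circ(bX^{q^j})=ab^{q^i}X^{q^{i+j}}$, with unit $X$; $\mathbb{F}_{q^l}\langle X^q\rangle$ is the subset with coefficients in $\mathbb{F}_{q^l}$. The $q$-degree of a nonzero element is the largest $i$ such that the coefficient of $X^{q^i}$ is nonzero; $\mathbb{F}_{q^m}\langle X^q\rangle_t$ is the set of elements of $q$-degree $<t$ (including $0$). Coprime means that the greatest right common divisor is $X$ (up to a nonzero scalar); the left least common multiple is a generator of the intersection of the left ideals generated. $\Phi:\prod_{i=1}^s\mathbb{F}_{q^m}\langle X^q\rangle_{d_i}\to\mathbb{F}_{q^m}\langle X^q\rangle_n$ is the lifting of the Chinese Remainder Theorem: $\Phi(p_1,\dots,p_s)$ is the remainder of the right division of $\sum_{i}p_i\circ S_{1,i}\circ b_i$ by the left least common multiple of $f_1,\dots,f_s$, where $S_{1,i}\circ b_i+S_{2,i}\circ f_i=X$; it satisfies $\Phi(\pi_1(p),\dots,\pi_s(p))=p$ for all $p$ of $q$-degree $<n$, $\pi_i(p)$ being the remainder of the right division of $p$ by $f_i$. A vector $e\in\mathbb{F}_{q^m}^n$ is identified with an element of $\prod_i\mathbb{F}_{q^m}\langle X^q\rangle_{d_i}$ via concatenated coefficient vectors. Write $E=\sum_{i=0}^{n-1}e_iX^{q^i}$.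 Its upper part is $\overline{E}=\sum_{i=k+\alpha}^{n-1}e_iX^{q^i}$. The support of a linearized polynomial is the $\mathbb{F}_q$-subspace of $\mathbb{F}_{q^m}$ spanned by its coefficients; $\mathcal{E}$ and $\overline{\mathcal{E}}$ are the supports of $E$ and $\overline{E}$, and $w_r(E)=\dim_{\mathbb{F}_q}\mathcal{E}$ is the rank weight. ($A$ is the polynomial defining the code $\{(\pi_1(P\circ A),\dots,\pi_s(P\circ A)) : \deg_q(P)<k\}$, to whose codewords the error $e$ is added.)
   Formalization: "Bounded by" is stated as "bounded below by": since e = 0 has positive probability, the probability given rank at most rl always strictly exceeds the displayed quantity (e.g. 3/4 against 2/3 for q=2, m=l=1, f_1=X^4, n=2, k=1, A=X, r=1), so an upper bound would be false. *)

theory Defs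
  imports
    "HOL-Probability.Probability"
    "HOL-Number_Theory.Prime_Powers"
    "HOL-Computational_Algebra.Computational_Algebra"
begin

section \<open>Linearized polynomials\<close>

text \<open>
  Linearized polynomials are taken literally, as ordinary polynomials all of whose exponents are
  powers of \<open>q\<close>. The product of the ring of linearized polynomials is then composition
  \<open>\<circ>\<^sub>p\<close> of polynomials, and its unit is \<open>X = [:0, 1:]\<close>.
\<close>

definition linearized :: "nat \<Rightarrow> 'a::field set \<Rightarrow> 'a poly set" where
  "linearized q K = {p. (\<forall>i. coeff p i \<in> K) \<and> (\<forall>i. coeff p i \<noteq> 0 \<longrightarrow> (\<exists>j. i = q ^ j))}"

lemma monom_pcompose_monom:
  fixes a b :: "'a::field"
  shows "monom a (q ^ i) \<circ>\<^sub>p monom b (q ^ j) = monom (a * b ^ (q ^ i)) (q ^ (i + j))"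
proof -
  have X: "(monom 1 k :: 'a poly) \<circ>\<^sub>p r = r ^ k" for k and r :: "'a poly"
  proof (induction k)
    case (Suc k)
    have "monom (1 :: 'a) (Suc k) = [:0, 1:] * monom 1 k"
      by (simp add: monom_Suc)
    then show ?case
      by (simp add: pcompose_mult pcompose_pCons Suc.IH)
  qed (simp add: pcompose_1)
  have "monom a (q ^ i) \<circ>\<^sub>p monom b (q ^ j) = smult a (monom 1 (q ^ i)) \<circ>\<^sub>p monom b (q ^ j)"
    by (simp add: smult_monom)
  also have "\<dots> = smult a (monom b (q ^ j) ^ (q ^ i))"
    by (simp only: pcompose_smult X)
  also have "\<dots> = monom (a * b ^ (q ^ i)) (q ^ (i + j))"
    by (simp add: monom_power smult_monom power_add mult.commute)
  finally show ?thesis .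
qed

text \<open>Only meaningful for nonzero linearized polynomials.\<close>

definition qdeg :: "nat \<Rightarrow> 'a::field poly \<Rightarrow> nat" where
  "qdeg q p = Max {i. coeff p (q ^ i) \<noteq> 0}"

definition rdivides :: "nat \<Rightarrow> 'a::field poly \<Rightarrow> 'a poly \<Rightarrow> bool" where
  "rdivides q d p \<longleftrightarrow> (\<exists>g \<in> linearized q UNIV. p = g \<circ>\<^sub>p d)"

definition is_gcrd :: "nat \<Rightarrow> 'a::field poly \<Rightarrow> 'a poly \<Rightarrow> 'a poly \<Rightarrow> bool" where
  "is_gcrd q d f g \<longleftrightarrow> d \<in> linearized q UNIV \<and> rdivides q d f \<and> rdivides q d g \<and>
     (\<forall>d' \<in> linearized q UNIV. rdivides q d' f \<and> rdivides q d' g \<longrightarrow> rdivides q d' d)"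

definition rcoprime :: "nat \<Rightarrow> 'a::field poly \<Rightarrow> 'a poly \<Rightarrow> bool" where
  "rcoprime q f g \<longleftrightarrow> (\<exists>c. c \<noteq> 0 \<and> is_gcrd q [:0, c:] f g)"

definition left_ideal :: "nat \<Rightarrow> 'a::field poly \<Rightarrow> 'a poly set" where
  "left_ideal q f = {g \<circ>\<^sub>p f | g. g \<in> linearized q UNIV}"

text \<open>
  For the empty family the intersection is the whole ring, so that the least common multiple is
  \<open>X\<close> up to a scalar. The generator is determined up to a nonzero scalar factor on the left only;
  neither coprimality nor the lifting below depends on which one is chosen.
\<close>

definition is_lclm :: "nat \<Rightarrow> 'i set \<Rightarrow> ('i \<Rightarrow> 'a::field poly) \<Rightarrow> 'a poly \<Rightarrow> bool" where
  "is_lclm q I f b \<longleftrightarrow> b \<in> linearized q UNIV \<and>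
     left_ideal q b = linearized q UNIV \<inter> (\<Inter>i\<in>I. left_ideal q (f i))"

definition lclm :: "nat \<Rightarrow> 'i set \<Rightarrow> ('i \<Rightarrow> 'a::field poly) \<Rightarrow> 'a poly" where
  "lclm q I f = (SOME b. is_lclm q I f b)"

text \<open>Remainder \<open>r\<close> of the right division \<open>p = g \<circ> f + r\<close>.\<close>

definition rrem :: "nat \<Rightarrow> 'a::field poly \<Rightarrow> 'a poly \<Rightarrow> 'a poly" where
  "rrem q p f = (THE r. r \<in> linearized q UNIV \<and> (r = 0 \<or> qdeg q r < qdeg q f) \<and>
     (\<exists>g \<in> linearized q UNIV. p = g \<circ>\<^sub>p f + r))"


section \<open>The lifting of the Chinese Remainder Theorem\<close>

definition cofactor :: "nat \<Rightarrow> nat \<Rightarrow> (nat \<Rightarrow> 'a::field poly) \<Rightarrow> nat \<Rightarrow> 'a poly" where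
  "cofactor q s f i = lclm q ({1..s} - {i}) f"

text \<open>
  \<open>S\<^sub>1\<close> with \<open>S\<^sub>1 \<circ> b + S\<^sub>2 \<circ> f = X\<close> for some \<open>S\<^sub>2\<close>. It is unique only up to left multiples, but
  the lifting does not depend on the choice.
\<close>

definition bezout_coeff :: "nat \<Rightarrow> 'a::field poly \<Rightarrow> 'a poly \<Rightarrow> 'a poly" where
  "bezout_coeff q b f = (SOME S1. S1 \<in> linearized q UNIV \<and>
     (\<exists>S2 \<in> linearized q UNIV. S1 \<circ>\<^sub>p b + S2 \<circ>\<^sub>p f = [:0, 1:]))"

definition crt_lift ::
    "nat \<Rightarrow> nat \<Rightarrow> (nat \<Rightarrow> 'a::field poly) \<Rightarrow> (nat \<Rightarrow> 'a poly) \<Rightarrow> 'a poly" where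
  "crt_lift q s f p =
     rrem q (\<Sum>i\<in>{1..s}. p i \<circ>\<^sub>p bezout_coeff q (cofactor q s f i) (f i) \<circ>\<^sub>p cofactor q s f i)
       (lclm q {1..s} f)"

text \<open>
  Splits a vector (indexed from \<open>0\<close>) into consecutive blocks of lengths \<open>d 1, d 2, \<dots>\<close>; the
  \<open>i\<close>-th block is the coefficient vector of the \<open>i\<close>-th linearized polynomial.
\<close>

definition vec_blocks :: "nat \<Rightarrow> (nat \<Rightarrow> nat) \<Rightarrow> (nat \<Rightarrow> 'a::field) \<Rightarrow> nat \<Rightarrow> 'a poly" where
  "vec_blocks q d e i = (\<Sum>j<d i. monom (e ((\<Sum>h\<in>{1..<i}. d h) + j)) (q ^ j))"


section \<open>Supports and rank weight\<close>

text \<open>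
  The field with \<open>q\<close> elements is a type of its own, included in the big field by a map \<open>\<iota>\<close>. The
  big field is thus a vector space over it, and span and dimension are those of the library.
\<close>

definition field_embedding :: "('k::field \<Rightarrow> 'a::field) \<Rightarrow> bool" where
  "field_embedding \<iota> \<longleftrightarrow> \<iota> 1 = 1 \<and> (\<forall>x y. \<iota> (x + y) = \<iota> x + \<iota> y) \<and> (\<forall>x y. \<iota> (x * y) = \<iota> x * \<iota> y)"

definition is_subfield :: "'a::field set \<Rightarrow> bool" where
  "is_subfield L \<longleftrightarrow> 0 \<in> L \<and> 1 \<in> L \<and> (\<forall>x\<in>L. \<forall>y\<in>L. x - y \<in> L \<and> x * y \<in> L) \<and> (\<forall>x\<in>L. inverse x \<in> L)"

definition scale_by :: "('k \<Rightarrow> 'a::field) \<Rightarrow> 'k \<Rightarrow> 'a \<Rightarrow> 'a" where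
  "scale_by \<iota> c x = \<iota> c * x"

lemma vector_space_scale_by:
  "field_embedding \<iota> \<Longrightarrow> vector_space (scale_by \<iota>)"
  by unfold_locales (simp_all add: field_embedding_def scale_by_def algebra_simps)

definition support :: "('k::field \<Rightarrow> 'a::field) \<Rightarrow> 'a poly \<Rightarrow> 'a set" where
  "support \<iota> p = module.span (scale_by \<iota>) (range (coeff p))"

definition rank_weight :: "('k::field \<Rightarrow> 'a::field) \<Rightarrow> 'a poly \<Rightarrow> nat" where
  "rank_weight \<iota> p = vector_space.dim (scale_by \<iota>) (support \<iota> p)"

definition upper_part :: "nat \<Rightarrow> nat \<Rightarrow> nat \<Rightarrow> 'a::field poly \<Rightarrow> 'a poly" where
  "upper_part q t n p = (\<Sum>i\<in>{t..<n}. monom (coeff p (q ^ i)) (q ^ i))"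

end

theory Submission
  imports Defs
begin

text \<open>
  The lifting \<open>\<Phi>\<close> is a bijection from vectors to linearized polynomials of \<open>q\<close>-degree less than
  \<open>n\<close>, so the coefficient vector of \<open>E\<close> is uniform. Among the vectors of length \<open>n\<close> whose entries span
  a space of dimension \<open>j\<close>, those whose last \<open>n - t\<close> entries already span it have the proportion
  \<open>q\<^sup>j\<^sup>t \<Prod>i<j. (q\<^sup>n\<^sup>-\<^sup>t - q\<^sup>i) / (q\<^sup>n - q\<^sup>i)\<close>, where \<open>t = k + \<alpha>\<close>. This is decreasing in \<open>j\<close>, hence at
  least its value at \<open>j = r l\<close> for every admissible rank.
\<close>

section \<open>Tuples of given rank over a finite field\<close>

text \<open>The number of tuples of length \<open>N\<close> and rank \<open>j\<close> depends on
  \<open>N\<close> only through the product of the \<open>q^N - q^i\<close> for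
  \<open>i < j\<close>. If the last \<open>n - t\<close> entries have rank \<open>j\<close>, each of
  the first \<open>t\<close> entries has \<open>q^j\<close> places in their span, so in the
  proportion everything else cancels, including the size of the big field. Raising \<open>j\<close>
  by one multiplies the proportion by \<open>(q^n - q^(j+t)) / (q^n - q^j)\<close>, which is at most
  1; the bound \<open>r * l \<le> n - t\<close> keeps all numerators positive. On the algebraic side
  the obstacle is that the lifting is built from \<open>SOME\<close> and \<open>THE\<close>, so
  every choice must first be shown to exist. Right division makes remainders unique and left ideals
  principal, which yields least common multiples and Bezout coefficients. The intersection of left
  ideals could still be generated by 0, in which case there would be no reduction at all; a nonzero
  common left multiple of \<open>q\<close>-degree at most \<open>n\<close> has to be
  produced.\<close>

lemma card_PiE_insert_Collect:
  assumes "finite I" "i \<notin> I" "\<And>j. j \<in> insert i I \<Longrightarrow> finite (T j)"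
  shows "card {e \<in> Pi\<^sub>E (insert i I) T. P e} = (\<Sum>g\<in>Pi\<^sub>E I T. card {y \<in> T i. P (g(i := y))})"
proof -
  \<comment> \<open>Fibring over the restriction to \<open>I\<close>: this is what turns the rank
    counts below into recursions on the index set.\<close>
  have "card {e \<in> Pi\<^sub>E (insert i I) T. P e} =
      card ((\<lambda>(g, y). g(i := y)) ` (SIGMA g:Pi\<^sub>E I T. {y \<in> T i. P (g(i := y))}))"
    by (rule arg_cong[where f = card]) (auto simp: PiE_insert_eq)
  also have "\<dots> = card (SIGMA g:Pi\<^sub>E I T. {y \<in> T i. P (g(i := y))})"
  proof (rule card_image, rule inj_onI)
    fix u v
    assume u: "u \<in> (SIGMA g:Pi\<^sub>E I T. {y \<in> T i. P (g(i := y))})"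
      and v: "v \<in> (SIGMA g:Pi\<^sub>E I T. {y \<in> T i. P (g(i := y))})"
      and eq: "(\<lambda>(g, y). g(i := y)) u = (\<lambda>(g, y). g(i := y)) v"
    \<comment> \<open>\<open>inj_combinator\<close> is stated for pairs with the new value
      first.\<close>
    have "prod.swap u = prod.swap v"
      by (rule inj_onD[OF inj_combinator[OF assms(2), of T]]) (use u v eq in auto)
    then show "u = v"
      by (metis swap_swap)
  qed
  also have "\<dots> = (\<Sum>g\<in>Pi\<^sub>E I T. card {y \<in> T i. P (g(i := y))})"
    using assms by (subst card_SigmaI) (auto intro!: finite_PiE)
  finally show ?thesis .
qed

text \<open>The factor for \<open>i = 0\<close> is split off and \<open>x\<close> is taken out of
  each of the others. It serves both for fixed \<open>n\<close> and for
  \<open>n = j\<close>.\<close>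

lemma prod_power_diff_Suc:
  fixes x :: real
  shows "(\<Prod>i<Suc j. x ^ Suc n - x ^ i) = (x ^ Suc n - 1) * x ^ j * (\<Prod>i<j. x ^ n - x ^ i)"
proof -
  have "(\<Prod>i<j. x ^ Suc n - x ^ Suc i) = (\<Prod>i<j. x * (x ^ n - x ^ i))"
    by (simp add: algebra_simps)
  then show ?thesis
    by (simp add: prod.lessThan_Suc_shift prod.distrib del: prod.lessThan_Suc)
qed

text \<open>One more unit of rank brings the factor \<open>(x^n - x^(R+t)) / (x^n - x^R)\<close>, at
  most 1. In the step \<open>Suc R \<le> n - t\<close>, so the denominators are positive and the
  accumulated product is nonnegative.\<close>

lemma rank_ratio_antimono:
  fixes x :: real
  assumes "1 < x" "j \<le> R" "R \<le> n - t" "t \<le> n"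
  shows "x ^ (R * t) * (\<Prod>i<R. (x ^ (n - t) - x ^ i) / (x ^ n - x ^ i)) \<le>
    x ^ (j * t) * (\<Prod>i<j. (x ^ (n - t) - x ^ i) / (x ^ n - x ^ i))"
  using assms(2,3)
proof (induction R rule: dec_induct)
  case (step R)
  define c where "c = x ^ (R * t) * (\<Prod>i<R. (x ^ (n - t) - x ^ i) / (x ^ n - x ^ i))"
  have lt: "x ^ i < x ^ n" "x ^ i \<le> x ^ (n - t)" if "i \<le> R" for i
    using that assms step.prems by (auto intro!: power_increasing power_strict_increasing)
  have c: "c \<ge> 0"
    unfolding c_def using assms lt
    by (intro mult_nonneg_nonneg prod_nonneg divide_nonneg_nonneg ballI)
      (auto intro: less_imp_le)
  have "x ^ t * ((x ^ (n - t) - x ^ R) / (x ^ n - x ^ R)) = (x ^ n - x ^ (R + t)) / (x ^ n - x ^ R)"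
    using assms by (simp add: algebra_simps flip: power_add)
  also have "\<dots> \<le> 1"
    using lt[of R] assms by (simp add: power_increasing)
  finally have "c * (x ^ t * ((x ^ (n - t) - x ^ R) / (x ^ n - x ^ R))) \<le> c"
    using c mult_left_le by blast
  then have "x ^ (Suc R * t) * (\<Prod>i<Suc R. (x ^ (n - t) - x ^ i) / (x ^ n - x ^ i)) \<le> c"
    by (simp add: c_def power_add algebra_simps)
  then show ?case
    using step by (simp add: c_def)
qed simp

text \<open>The counting is done in an abstract space. Here \<open>'a\<close> is the type of scalars
  and \<open>'b\<close> that of vectors, so \<open>CARD('a)\<close> will become \<open>q\<close> and
  \<open>CARD('b)\<close> will become \<open>q^m\<close>.\<close>

locale finite_vector_space = finite_dimensional_vector_space +
  assumes finite_scalars: "finite (UNIV :: 'a set)"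
    and finite_vectors: "finite (UNIV :: 'b set)"
begin

text \<open>A new independent vector \<open>b\<close> multiplies the size by
  \<open>CARD('a)\<close>, since in \<open>c *s b + x\<close> with \<open>x\<close> in the old span
  both \<open>c\<close> and \<open>x\<close> are determined.\<close>

lemma card_span_independent:
  assumes "independent B"
  shows "finite (span B) \<and> card (span B) = CARD('a) ^ card B"
proof -
  have "finite B"
    using assms finiteI_independent by blast
  then show ?thesis
    using assms
  proof (induction B rule: finite_induct)
    case (insert b B)
    then have b: "b \<notin> span B" "independent B"
      using independent_insert by auto
    let ?f = "\<lambda>(c, x). c *s b + x"
    have im: "span (insert b B) = ?f ` (UNIV \<times> span B)"
    proof (rule set_eqI)
      fix x
      have "x - c *s b \<in> span B \<longleftrightarrow> (\<exists>y\<in>span B. x = c *s b + y)" for c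
        by (metis add_diff_cancel_left' add.commute diff_add_cancel)
      then show "x \<in> span (insert b B) \<longleftrightarrow> x \<in> ?f ` (UNIV \<times> span B)"
        unfolding span_breakdown_eq by auto
    qed
    have "inj_on ?f (UNIV \<times> span B)"
    proof (rule inj_onI, clarsimp)
      fix c x c' x'
      assume x: "x \<in> span B" "x' \<in> span B" and eq: "c *s b + x = c' *s b + x'"
      have d: "(c - c') *s b = x' - x"
        using eq by (simp add: algebra_simps)
      then have "(c - c') *s b \<in> span B"
        using x by (simp add: span_diff)
      have "c = c'"
      proof (rule ccontr)
        assume "c \<noteq> c'"
        then have "b \<in> span B"
          using span_scale[OF \<open>(c - c') *s b \<in> span B\<close>, of "inverse (c - c')"] by simp
        with b show False
          by blast
      qed
      with eq show "c = c' \<and> x = x'"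
        by simp
    qed
    then show ?case
      using insert b finite_scalars im by (simp add: card_image card_cartesian_product)
  qed simp
qed

lemma card_span: "card (span S) = CARD('a) ^ dim S"
proof -
  obtain B where B: "B \<subseteq> S" "independent B" "S \<subseteq> span B" "card B = dim S"
    using basis_exists by blast
  then have "span B = span S"
    using span_mono span_minimal subspace_span by (metis subset_antisym)
  then show ?thesis
    using card_span_independent[OF B(2)] B(4) by simp
qed

definition rank_tuples :: "'i set \<Rightarrow> nat \<Rightarrow> ('i \<Rightarrow> 'b) set" where
  "rank_tuples I j = {e \<in> I \<rightarrow>\<^sub>E UNIV. dim (e ` I) = j}"

text \<open>A vector inside the span keeps the dimension, one outside raises it by 1. The exclusive
  cases are written as a sum so that the total over all tuples splits into two counts.\<close>

lemma card_dim_insert: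
  "real (card {y. dim (insert y S) = j}) =
     (if dim S = j then real CARD('a) ^ j else 0) +
     (if Suc (dim S) = j then real CARD('b) - real CARD('a) ^ (j - 1) else 0)"
proof -
  have compl: "{y. y \<notin> span S} = UNIV - span S"
    by auto
  have c: "real (card {y. y \<notin> span S}) = real CARD('b) - real CARD('a) ^ dim S"
    unfolding compl using finite_scalars finite_vectors card_span[of S] card_mono[OF finite_vectors, of "span S"]
    by (subst card_Diff_subset) (auto intro: finite_subset simp: of_nat_diff)
  consider "dim S = j" | "Suc (dim S) = j" | "dim S \<noteq> j" "Suc (dim S) \<noteq> j"
    by blast
  then show ?thesis
  proof cases
    case 1
    then have "{y. dim (insert y S) = j} = span S"
      by (auto simp: dim_insert)
    then show ?thesis
      using 1 by (simp add: card_span)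
  next
    case 2
    then have "{y. dim (insert y S) = j} = {y. y \<notin> span S}"
      by (auto simp: dim_insert)
    then show ?thesis
      using 2 c by auto
  next
    case 3
    then have "{y. dim (insert y S) = j} = {}"
      by (auto simp: dim_insert)
    then show ?thesis
      using 3 by simp
  qed
qed

lemma finite_tuples: "finite I \<Longrightarrow> finite (I \<rightarrow>\<^sub>E (UNIV :: 'b set))"
  using finite_scalars finite_vectors by (intro finite_PiE) auto

text \<open>Before the last entry is added the rank is \<open>j\<close> or \<open>j - 1\<close>. The
  case \<open>j = 0\<close> is separate because \<open>j - 1\<close> is truncated there.\<close>

lemma card_rank_tuples_insert:
  assumes "finite I" "i \<notin> I"
  shows "real (card (rank_tuples (insert i I) j)) =
    real CARD('a) ^ j * real (card (rank_tuples I j)) +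
    (if j = 0 then 0
     else (real CARD('b) - real CARD('a) ^ (j - 1)) * real (card (rank_tuples I (j - 1))))"
proof -
  have im: "(g(i := y)) ` insert i I = insert y (g ` I)" for g and y :: 'b
    using assms by (auto simp: image_iff)
  have "real (card (rank_tuples (insert i I) j)) =
      (\<Sum>g\<in>I \<rightarrow>\<^sub>E UNIV. real (card {y. dim (insert y (g ` I)) = j}))"
    unfolding rank_tuples_def 
    by (subst card_PiE_insert_Collect[OF assms]) (simp_all only: im finite_scalars finite_vectors UNIV_I simp_thms of_nat_sum)
  also have "\<dots> = (\<Sum>g\<in>I \<rightarrow>\<^sub>E UNIV. (if dim (g ` I) = j then real CARD('a) ^ j else 0)) +
      (\<Sum>g\<in>I \<rightarrow>\<^sub>E UNIV. (if Suc (dim (g ` I)) = j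
        then real CARD('b) - real CARD('a) ^ (j - 1) else 0))"
    by (simp add: card_dim_insert sum.distrib)
  also have "(\<Sum>g\<in>I \<rightarrow>\<^sub>E UNIV. (if dim (g ` I) = j then real CARD('a) ^ j else 0)) =
      real CARD('a) ^ j * real (card (rank_tuples I j))"
    using finite_tuples[OF assms(1)]
    by (simp add: rank_tuples_def Int_def flip: sum.inter_filter)
  also have "(\<Sum>g\<in>I \<rightarrow>\<^sub>E UNIV. (if Suc (dim (g ` I)) = j
        then real CARD('b) - real CARD('a) ^ (j - 1) else 0)) =
      (if j = 0 then 0
       else (real CARD('b) - real CARD('a) ^ (j - 1)) * real (card (rank_tuples I (j - 1))))"
    using finite_tuples[OF assms(1)]
    by (cases j) (simp_all add: rank_tuples_def Int_def flip: sum.inter_filter)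
  finally show ?thesis .
qed

text \<open>
  The number of tuples of rank \<open>j\<close> is a Gaussian binomial coefficient times
  \<open>\<Prod>i<j. q\<^sup>n - q\<^sup>i\<close>. Adding one entry at a time gives a recursion for it and avoids
  counting subspaces.
\<close>

lemma card_rank_tuples:
  assumes "finite I"
  shows "real (card (rank_tuples I j)) * (\<Prod>i<j. real CARD('a) ^ j - real CARD('a) ^ i) =
    (\<Prod>i<j. real CARD('b) - real CARD('a) ^ i) *
    (\<Prod>i<j. real CARD('a) ^ card I - real CARD('a) ^ i)"
  using assms
proof (induction I arbitrary: j rule: finite_induct)
  case empty
  show ?case
  proof (cases j)
    case 0
    then show ?thesis
      by (simp add: rank_tuples_def)
  next
    case (Suc j')
    \<comment> \<open>The factor for \<open>i = 0\<close> is \<open>1 - 1\<close>.\<close>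
    then have "(\<Prod>i<j. real CARD('a) ^ card ({} :: 'c set) - real CARD('a) ^ i) = 0"
      by (intro prod_zero bexI[of _ 0]) auto
    moreover have "rank_tuples ({} :: 'c set) j = {}"
      using Suc by (auto simp: rank_tuples_def)
    ultimately show ?thesis
      by simp
  qed
next
  case (insert i I)
  show ?case
  proof (cases j)
    case 0
    then show ?thesis
      using insert.hyps insert.IH[of 0] card_rank_tuples_insert[of I i 0] by simp
  next
    case (Suc j')
    define x where "x = real CARD('a)"
    define Q where "Q = real CARD('b)"
    define D where "D j = (\<Prod>i<j. x ^ j - x ^ i)" for j
    define PQ where "PQ j = (\<Prod>i<j. Q - x ^ i)" for j
    define F where "F n j = (\<Prod>i<j. x ^ n - x ^ i)" for n j
    define T where "T j = real (card (rank_tuples I j))" for j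
    have IH: "T j * D j = PQ j * F (card I) j" for j
      using insert.IH[of j] by (simp add: x_def Q_def D_def PQ_def F_def T_def)
    have rec: "real (card (rank_tuples (insert i I) j)) = x ^ Suc j' * T (Suc j') + (Q - x ^ j') * T j'"
      using card_rank_tuples_insert[OF insert.hyps(1,2), of j] Suc
      by (simp add: x_def Q_def T_def)
    have DS: "D (Suc j') = (x ^ Suc j' - 1) * x ^ j' * D j'"
      unfolding D_def by (rule prod_power_diff_Suc)
    have FS: "F (Suc (card I)) (Suc j') = (x ^ Suc (card I) - 1) * x ^ j' * F (card I) j'"
      unfolding F_def by (rule prod_power_diff_Suc)
    have PS: "PQ (Suc j') = PQ j' * (Q - x ^ j')"
      by (simp add: PQ_def)
    have FS': "F (card I) (Suc j') = F (card I) j' * (x ^ card I - x ^ j')"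
      by (simp add: F_def)
    have "real (card (rank_tuples (insert i I) j)) * D (Suc j') =
        x ^ Suc j' * (T (Suc j') * D (Suc j')) +
        (Q - x ^ j') * ((x ^ Suc j' - 1) * x ^ j') * (T j' * D j')"
      by (simp add: rec DS algebra_simps)
    \<comment> \<open>With the common factors removed and \<open>N = card I\<close>, what remains is
      \<open>x^(j'+1) * (x^N - x^j') + (x^(j'+1) - 1) * x^j' = x^j' * (x^(N+1) - 1)\<close>.\<close>
    also have "\<dots> = PQ (Suc j') * F (Suc (card I)) (Suc j')"
      unfolding IH by (simp add: PS FS FS' algebra_simps)
    finally show ?thesis
      using Suc insert.hyps by (simp add: x_def Q_def D_def PQ_def F_def)
  qed
qed

text \<open>Each entry over \<open>J\<close> ranges independently over the span of the entries over
  \<open>I\<close>, which has \<open>CARD('a) ^ j\<close> elements.\<close>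

lemma card_rank_tuples_span_eq:
  assumes "finite J" "finite I" "I \<inter> J = {}"
  shows "card {e \<in> I \<union> J \<rightarrow>\<^sub>E UNIV. dim (e ` I) = j \<and> e ` J \<subseteq> span (e ` I)} =
    CARD('a) ^ (j * card J) * card (rank_tuples I j)"
  using assms
proof (induction J rule: finite_induct)
  case empty
  then show ?case
    by (simp add: rank_tuples_def)
next
  case (insert i J)
  let ?P = "\<lambda>J e. dim (e ` I) = j \<and> e ` J \<subseteq> span (e ` I)"
  have i: "i \<notin> I \<union> J"
    using insert by auto
  have "?P (insert i J) (g(i := y)) \<longleftrightarrow> ?P J g \<and> y \<in> span (g ` I)" for g and y :: 'b
  proof -
    have "(g(i := y)) ` I = g ` I" "(g(i := y)) ` J = g ` J"
      using i by auto
    then show ?thesis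
      unfolding image_insert by (simp only: insert_subset fun_upd_same) blast
  qed
  then have "card {e \<in> insert i (I \<union> J) \<rightarrow>\<^sub>E UNIV. ?P (insert i J) e} =
      (\<Sum>g\<in>I \<union> J \<rightarrow>\<^sub>E UNIV. card {y. ?P J g \<and> y \<in> span (g ` I)})"
    using insert i finite_scalars finite_vectors by (subst card_PiE_insert_Collect) auto
  also have "\<dots> = (\<Sum>g\<in>I \<union> J \<rightarrow>\<^sub>E UNIV. if ?P J g then CARD('a) ^ j else 0)"
    by (rule sum.cong) (auto simp: card_span)
  also have "\<dots> = CARD('a) ^ j * card {g \<in> I \<union> J \<rightarrow>\<^sub>E UNIV. ?P J g}"
    using finite_tuples[of "I \<union> J"] insert by (simp flip: sum.inter_filter)
  finally show ?case
    using insert by (simp add: power_add)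
qed

lemma card_scalars_gt_1: "CARD('a) > 1"
  using card_mono[OF finite_scalars, of "{0, 1}"] by simp

text \<open>The combinatorial core, with \<open>t\<close> in the role of
  \<open>k + \<alpha>\<close>. Both sets are split by exact rank \<open>j \<le> R\<close>; in each
  class the proportion is \<open>\<rho> j\<close>, which is at least \<open>\<rho> R\<close>. The
  inequality is multiplied out so that empty classes need no care.\<close>

lemma card_span_eq_rank_le_ge:
  assumes "t \<le> n" "R \<le> n - t"
  shows "real CARD('a) ^ (R * t) *
      (\<Prod>i<R. (real CARD('a) ^ (n - t) - real CARD('a) ^ i) / (real CARD('a) ^ n - real CARD('a) ^ i)) *
      real (card {e \<in> {..<n} \<rightarrow>\<^sub>E UNIV. dim (e ` {..<n}) \<le> R}) \<le>
    real (card {e \<in> {..<n} \<rightarrow>\<^sub>E UNIV.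
      span (e ` {t..<n}) = span (e ` {..<n}) \<and> dim (e ` {..<n}) \<le> R})"
proof -
  define x where "x = real CARD('a)"
  define \<rho> where "\<rho> j = x ^ (j * t) * (\<Prod>i<j. (x ^ (n - t) - x ^ i) / (x ^ n - x ^ i))" for j
  define B where "B j = {e \<in> {..<n} \<rightarrow>\<^sub>E UNIV. dim (e ` {t..<n}) = j \<and> e ` {..<t} \<subseteq> span (e ` {t..<n})}" for j
  have x: "x > 1"
    using card_scalars_gt_1 by (simp add: x_def)
  have un: "{t..<n} \<union> {..<t} = {..<n}"
    using assms(1) by auto
  \<comment> \<open>\<open>B j\<close> has the shape that was counted above; this identifies it with
    the event of equal spans at rank \<open>j\<close>.\<close>
  have B: "e \<in> B j \<longleftrightarrow> e \<in> {..<n} \<rightarrow>\<^sub>E UNIV \<and> span (e ` {t..<n}) = span (e ` {..<n}) \<and> dim (e ` {..<n}) = j"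
    for e j
  proof -
    have "e ` {..<t} \<subseteq> span (e ` {t..<n}) \<longleftrightarrow> span (e ` {t..<n}) = span (e ` {..<n})"
      unfolding span_eq un[symmetric] image_Un by (auto intro: span_base span_mono[THEN subsetD])
    moreover have "dim (e ` {t..<n}) = dim (e ` {..<n})"
      if "span (e ` {t..<n}) = span (e ` {..<n})"
      using arg_cong[OF that, of dim] by (simp only: dim_span)
    ultimately show ?thesis
      unfolding B_def by auto
  qed
  have ge: "\<rho> R * real (card (rank_tuples {..<n} j)) \<le> real (card (B j))" if j: "j \<le> R" for j
  proof -
    define N where "N = real (card (rank_tuples {..<n} j :: (nat \<Rightarrow> 'b) set))"
    define M where "M = real (card (rank_tuples {t..<n} j :: (nat \<Rightarrow> 'b) set))"
    define D where "D = (\<Prod>i<j. x ^ j - x ^ i)"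
    define F where "F k = (\<Prod>i<j. x ^ k - x ^ i)" for k
    define PQ where "PQ = (\<Prod>i<j. real CARD('b) - x ^ i)"
    have pos: "(\<Prod>i<j. x ^ k - x ^ i) > 0" if "j \<le> k" for k
      using x that by (intro prod_pos) (auto intro!: power_strict_increasing)
    have D: "D > 0" and Fn: "F n > 0"
      using pos[of j] pos[of n] j assms by (auto simp: D_def F_def)
    have eqs: "N * D = PQ * F n" "M * D = PQ * F (n - t)"
      using card_rank_tuples[of "{..<n}" j] card_rank_tuples[of "{t..<n}" j]
      by (simp_all add: N_def M_def D_def PQ_def F_def x_def)
    \<comment> \<open>Only \<open>D\<close> and \<open>F n\<close>, which are positive, are
      cancelled. \<open>PQ\<close> is never divided by, as it vanishes when \<open>j\<close> exceeds
      the dimension of the whole space.\<close>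
    have "(M * F n) * D = (PQ * F (n - t)) * F n"
      unfolding eqs(2)[symmetric] by (simp only: mult_ac)
    also have "\<dots> = (PQ * F n) * F (n - t)"
      by (simp only: mult_ac)
    also have "\<dots> = (N * F (n - t)) * D"
      unfolding eqs(1)[symmetric] by (simp only: mult_ac)
    finally have "M * F n = N * F (n - t)"
      using D by simp
    then have M: "M = N * (F (n - t) / F n)"
      using Fn by (simp add: field_simps)
    have "real (card (B j)) = x ^ (j * t) * M"
      using card_rank_tuples_span_eq[of "{..<t}" "{t..<n}" j]
      by (simp add: B_def un M_def x_def Int_commute ivl_disj_int_one)
    also have "\<dots> = \<rho> j * N"
      unfolding M \<rho>_def F_def by (simp add: prod_dividef)
    finally show ?thesis
      using mult_right_mono[OF rank_ratio_antimono[OF x j assms(2,1)], of N]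
      by (simp add: \<rho>_def N_def)
  qed
  have fin: "finite ({..<n} \<rightarrow>\<^sub>E (UNIV :: 'b set))"
    by (intro finite_tuples) simp
  have "{e \<in> {..<n} \<rightarrow>\<^sub>E UNIV. dim (e ` {..<n}) \<le> R} = (\<Union>j\<le>R. rank_tuples {..<n} j)"
    by (auto simp: rank_tuples_def)
  then have "card {e \<in> {..<n} \<rightarrow>\<^sub>E UNIV. dim (e ` {..<n}) \<le> R} =
      (\<Sum>j\<le>R. card (rank_tuples {..<n} j :: (nat \<Rightarrow> 'b) set))"
    using fin by (simp only:) (subst card_UN_disjoint, auto simp: rank_tuples_def)
  then have "\<rho> R * real (card {e \<in> {..<n} \<rightarrow>\<^sub>E UNIV. dim (e ` {..<n}) \<le> R}) =
      (\<Sum>j\<le>R. \<rho> R * real (card (rank_tuples {..<n} j :: (nat \<Rightarrow> 'b) set)))"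
    by (simp add: sum_distrib_left)
  also have "\<dots> \<le> real (\<Sum>j\<le>R. card (B j))"
    unfolding of_nat_sum by (intro sum_mono ge) simp
  also have "(\<Sum>j\<le>R. card (B j)) = card (\<Union>j\<le>R. B j)"
    using fin by (subst card_UN_disjoint) (auto simp: B_def)
  also have "(\<Union>j\<le>R. B j) = {e \<in> {..<n} \<rightarrow>\<^sub>E UNIV.
      span (e ` {t..<n}) = span (e ` {..<n}) \<and> dim (e ` {..<n}) \<le> R}"
    by (auto simp: B)
  finally show ?thesis
    by (simp add: \<rho>_def x_def)
qed

end

lemma finite_vector_space_scale_by:
  fixes \<iota> :: "'k::finite_field \<Rightarrow> 'a::finite_field"
  assumes "field_embedding \<iota>"
  obtains B where "finite_vector_space (scale_by \<iota>) B"
proof -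
  interpret vector_space "scale_by \<iota>"
    using assms by (rule vector_space_scale_by)
  obtain B where "independent B" "UNIV \<subseteq> span B"
    using basis_exists[of UNIV] by metis
  moreover have "finite B"
    by (rule finite)
  ultimately have "finite_vector_space (scale_by \<iota>) B"
    by unfold_locales (simp_all add: top.extremum_unique)
  then show thesis
    by (rule that)
qed

section \<open>The ring of linearized polynomials\<close>

lemma monom_pcompose:
  fixes r :: "'a::comm_semiring_1 poly"
  shows "monom a k \<circ>\<^sub>p r = smult a (r ^ k)"
  by (induction k) (simp_all add: monom_Suc pcompose_pCons monom_0)

lemma mem_left_ideal: "p \<in> left_ideal q f \<longleftrightarrow> (\<exists>g\<in>linearized q UNIV. p = g \<circ>\<^sub>p f)"
  by (auto simp: left_ideal_def)

text \<open>Additivity of the \<open>q\<close>-th power is the one consequence of the characteristic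
  on which the ring laws rest. It is required for polynomials because composition substitutes
  polynomials. The parameter \<open>ty\<close> pins the coefficient type.\<close>

locale linearized_ring =
  fixes q :: nat and ty :: "'a::field itself"
  assumes q_gt_1: "q > 1"
    and power_q_add: "(x + y :: 'a poly) ^ q = x ^ q + y ^ q"
begin

abbreviation lin :: "'a poly set" where
  "lin \<equiv> linearized q UNIV"

lemma power_power_q_add: "(x + y :: 'a poly) ^ (q ^ j) = x ^ (q ^ j) + y ^ (q ^ j)"
proof (induction j)
  case (Suc j)
  then show ?case
    by (simp add: power_mult power_q_add mult.commute[of q])
qed simp

lemma lin_0: "0 \<in> lin"
  by (simp add: linearized_def)

lemma lin_monom: "monom a (q ^ j) \<in> lin"
  by (auto simp: linearized_def)

lemma lin_X: "[:0, a:] \<in> lin"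
  using lin_monom[of a 0] by (simp add: monom_Suc monom_0)

lemma lin_add: "p \<in> lin \<Longrightarrow> r \<in> lin \<Longrightarrow> p + r \<in> lin"
  unfolding linearized_def by (simp, metis add_0)

lemma lin_diff: "p \<in> lin \<Longrightarrow> r \<in> lin \<Longrightarrow> p - r \<in> lin"
  using lin_add[of p "- r"] by (simp add: linearized_def)

lemma lin_sum: "(\<And>i. i \<in> I \<Longrightarrow> p i \<in> lin) \<Longrightarrow> sum p I \<in> lin"
  by (induction I rule: infinite_finite_induct) (auto simp: lin_0 lin_add)

lemma coeff_sum_monom_power_q:
  "coeff (\<Sum>j<N. monom (c j :: 'a) (q ^ j)) (q ^ i) = (if i < N then c i else 0)"
proof -
  have "coeff (\<Sum>j<N. monom (c j) (q ^ j)) (q ^ i) = (\<Sum>j<N. if j = i then c j else 0)"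
    unfolding coeff_sum coeff_monom using q_gt_1 by (simp add: power_inject_exp)
  then show ?thesis
    by simp
qed

lemma lin_eqI:
  assumes "p \<in> lin" "r \<in> lin" "\<And>i. coeff p (q ^ i) = coeff r (q ^ i)"
  shows "p = r"
proof (rule poly_eqI)
  fix i
  show "coeff p i = coeff r i"
  proof (cases "\<exists>j. i = q ^ j")
    case False
    then have "coeff p i = 0" "coeff r i = 0"
      using assms(1,2) unfolding linearized_def by blast+
    then show ?thesis
      by simp
  qed (use assms(3) in auto)
qed

lemma lin_expand:
  assumes "p \<in> lin" "degree p < q ^ N"
  shows "p = (\<Sum>j<N. monom (coeff p (q ^ j)) (q ^ j))"
proof (rule lin_eqI)
  fix i
  have "coeff p (q ^ i) = 0" if "i \<ge> N"
  proof -
    have "q ^ N \<le> q ^ i"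
      using that q_gt_1 by (simp add: power_increasing)
    then show ?thesis
      using assms(2) by (simp add: coeff_eq_0)
  qed
  then show "coeff p (q ^ i) = coeff (\<Sum>j<N. monom (coeff p (q ^ j)) (q ^ j)) (q ^ i)"
    unfolding coeff_sum_monom_power_q by auto
qed (use assms in \<open>auto intro: lin_sum lin_monom\<close>)

lemma degree_sum_monom_power_q: "degree (\<Sum>j<N. monom (c j :: 'a) (q ^ j)) < q ^ N"
proof (cases N)
  case (Suc M)
  have "degree (\<Sum>j<N. monom (c j :: 'a) (q ^ j)) \<le> q ^ M"
  proof (rule degree_sum_le)
    fix j
    assume "j \<in> {..<N}"
    then have "q ^ j \<le> q ^ M"
      using q_gt_1 Suc by (intro power_increasing) auto
    then show "degree (monom (c j) (q ^ j)) \<le> q ^ M"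
      using degree_monom_le order_trans by blast
  qed simp
  also have "q ^ M < q ^ N"
    using q_gt_1 Suc by (simp add: power_strict_increasing)
  finally show ?thesis .
qed simp

lemma lin_induct [consumes 1, case_names zero monom add]:
  assumes "p \<in> lin" and "P 0" and monom: "\<And>a j. P (monom a (q ^ j))"
    and add: "\<And>p r. p \<in> lin \<Longrightarrow> r \<in> lin \<Longrightarrow> P p \<Longrightarrow> P r \<Longrightarrow> P (p + r)"
  shows "P p"
proof -
  have "P (\<Sum>j<N. monom (c j) (q ^ j))" for c and N :: nat
    by (induction N) (auto intro!: assms lin_sum lin_monom)
  \<comment> \<open>A crude number of terms, sufficient for \<open>lin_expand\<close>.\<close>
  moreover have "degree p < q ^ degree p"
    using q_gt_1 by (simp add: power_gt_expt)
  ultimately show ?thesis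
    by (subst lin_expand[OF assms(1)]) auto
qed

text \<open>Distributivity on this side relies on the outer polynomial being linearized: on
  monomials it is additivity of \<open>q ^ j\<close>-th powers.\<close>

lemma pcompose_add_right: "p \<in> lin \<Longrightarrow> p \<circ>\<^sub>p (x + y) = p \<circ>\<^sub>p x + p \<circ>\<^sub>p y"
proof (induction p rule: lin_induct)
  case (monom a j)
  show ?case
    by (simp add: monom_pcompose power_power_q_add smult_add_right)
qed (simp_all add: pcompose_add)

lemma pcompose_zero_right: "p \<in> lin \<Longrightarrow> p \<circ>\<^sub>p 0 = 0"
  using pcompose_add_right[of p 0 0] unfolding add_0 by (simp only: add_cancel_right_right)

lemma pcompose_diff_right: "p \<in> lin \<Longrightarrow> p \<circ>\<^sub>p (x - y) = p \<circ>\<^sub>p x - p \<circ>\<^sub>p y"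
  using pcompose_add_right[of p "x - y" y] by simp

lemma lin_pcompose: "p \<in> lin \<Longrightarrow> r \<in> lin \<Longrightarrow> p \<circ>\<^sub>p r \<in> lin"
proof (induction p rule: lin_induct)
  case (monom a j)
  then show ?case
  proof (induction r rule: lin_induct)
    case (monom b i)
    then show ?case
      by (simp add: monom_pcompose_monom lin_monom)
  qed (simp_all add: pcompose_zero_right pcompose_add_right lin_monom lin_0 lin_add)
qed (simp_all add: pcompose_add lin_0 lin_add)

lemma degree_lin:
  assumes "p \<in> lin" "p \<noteq> 0"
  shows "degree p = q ^ qdeg q p"
proof -
  have "coeff p (degree p) \<noteq> 0"
    using assms by simp
  then obtain j where j: "degree p = q ^ j"
    using assms(1) unfolding linearized_def by blast
  have "i \<le> j" if "coeff p (q ^ i) \<noteq> 0" for i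
    using le_degree[OF that] j q_gt_1 by simp
  moreover have "coeff p (q ^ j) \<noteq> 0"
    using assms j by (metis leading_coeff_0_iff)
  moreover have "finite {i. coeff p (q ^ i) \<noteq> 0}"
    by (rule finite_subset[of _ "{..j}"]) (use calculation in auto)
  ultimately have "qdeg q p = j"
    unfolding qdeg_def by (intro Max_eqI) auto
  with j show ?thesis
    by simp
qed

lemma degree_lin_pos: "p \<in> lin \<Longrightarrow> p \<noteq> 0 \<Longrightarrow> degree p > 0"
  using degree_lin q_gt_1 by simp

text \<open>Nonzero linearized polynomials have positive degree while \<open>degree 0 = 0\<close>,
  so the ordinary degree absorbs the exceptional zero remainder.\<close>

lemma lin_degree_less_iff:
  assumes "r \<in> lin" "f \<in> lin" "f \<noteq> 0"
  shows "degree r < degree f \<longleftrightarrow> r = 0 \<or> qdeg q r < qdeg q f"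
  using assms degree_lin degree_lin_pos q_gt_1 by (cases "r = 0") auto

section \<open>Right division and left ideals\<close>

lemma right_division:
  assumes "f \<in> lin" "f \<noteq> 0" "p \<in> lin"
  shows "\<exists>g\<in>lin. \<exists>r\<in>lin. p = g \<circ>\<^sub>p f + r \<and> degree r < degree f"
  using assms(3)
proof (induction "degree p" arbitrary: p rule: less_induct)
  case less
  show ?case
  proof (cases "degree p < degree f")
    case True
    then show ?thesis
      using less.prems lin_0 by (intro bexI[of _ 0] bexI[of _ p]) auto
  next
    case False
    have p0: "p \<noteq> 0"
      using False degree_lin_pos[OF assms(1,2)] by auto
    define k where "k = qdeg q p - qdeg q f"
    have le: "qdeg q f \<le> qdeg q p"
      using False degree_lin[OF assms(1,2)] degree_lin[OF less.prems p0] q_gt_1 by simp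
    \<comment> \<open>Composing with \<open>X^(q^k)\<close> on the left raises the leading
      coefficient of \<open>f\<close> to the power \<open>q^k\<close>, hence the denominator;
      \<open>q\<close>-degrees add, hence \<open>k\<close>.\<close>
    define g where "g = monom (lead_coeff p / lead_coeff f ^ (q ^ k)) (q ^ k)"
    have g: "g \<in> lin"
      by (simp add: g_def lin_monom)
    have gc: "lead_coeff p / lead_coeff f ^ (q ^ k) \<noteq> 0"
      using p0 assms by simp
    have deg: "degree (g \<circ>\<^sub>p f) = degree p"
      using gc le degree_lin[OF assms(1,2)] degree_lin[OF less.prems p0]
      by (simp add: g_def degree_pcompose degree_monom_eq k_def flip: power_add)
    have "lead_coeff (g \<circ>\<^sub>p f) = lead_coeff p"
      using gc assms degree_lin_pos[OF assms(1,2)]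
      by (subst lead_coeff_comp) (simp_all add: g_def degree_monom_eq)
    then have c: "coeff (p - g \<circ>\<^sub>p f) (degree p) = 0"
      using deg by simp
    define p' where "p' = p - g \<circ>\<^sub>p f"
    have p': "p' \<in> lin"
      unfolding p'_def by (intro lin_diff lin_pcompose less.prems g assms)
    have d': "degree p' < degree p"
    proof (cases "p' = 0")
      case True
      then show ?thesis
        using degree_lin_pos[OF less.prems p0] by simp
    next
      case False
      then show ?thesis
        using c deg by (intro degree_less_if_less_eqI) (auto simp: p'_def intro: degree_diff_le)
    qed
    obtain h r where h: "h \<in> lin" "r \<in> lin" "p' = h \<circ>\<^sub>p f + r" "degree r < degree f"
      using less.hyps[OF d' p'] by blast
    have "p = (g + h) \<circ>\<^sub>p f + r"
      using h(3) by (simp add: p'_def pcompose_add algebra_simps)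
    then show ?thesis
      using h g lin_add by blast
  qed
qed

text \<open>Degrees multiply under composition, and a nonzero linearized quotient has degree at
  least 1.\<close>

lemma left_ideal_degree_less:
  assumes "f \<in> lin" "f \<noteq> 0" "p \<in> left_ideal q f" "degree p < degree f"
  shows "p = 0"
proof -
  obtain g where g: "g \<in> lin" "p = g \<circ>\<^sub>p f"
    using assms by (auto simp: mem_left_ideal)
  show ?thesis
  proof (rule ccontr)
    assume "p \<noteq> 0"
    then have "g \<noteq> 0"
      using g by auto
    then have "degree g > 0"
      using g degree_lin_pos by blast
    then show False
      using assms(4) g by (simp add: degree_pcompose)
  qed
qed

lemma left_ideal_0: "0 \<in> left_ideal q (f :: 'a poly)"
  unfolding mem_left_ideal using lin_0 by (intro bexI[of _ 0]) auto

lemma left_ideal_add: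
  "x \<in> left_ideal q f \<Longrightarrow> y \<in> left_ideal q f \<Longrightarrow> x + y \<in> left_ideal q (f :: 'a poly)"
  unfolding mem_left_ideal by (metis lin_add pcompose_add)

lemma left_ideal_diff:
  "x \<in> left_ideal q f \<Longrightarrow> y \<in> left_ideal q f \<Longrightarrow> x - y \<in> left_ideal q (f :: 'a poly)"
  unfolding mem_left_ideal by (metis lin_diff pcompose_diff)

lemma left_ideal_sum:
  "(\<And>i. i \<in> I \<Longrightarrow> x i \<in> left_ideal q f) \<Longrightarrow> sum x I \<in> left_ideal q (f :: 'a poly)"
  by (induction I rule: infinite_finite_induct) (auto simp: left_ideal_0 left_ideal_add)

lemma left_ideal_pcompose:
  "g \<in> lin \<Longrightarrow> x \<in> left_ideal q f \<Longrightarrow> g \<circ>\<^sub>p x \<in> left_ideal q f"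
  unfolding mem_left_ideal by (metis lin_pcompose pcompose_assoc)

lemma left_ideal_self: "f \<in> left_ideal q (f :: 'a poly)"
  unfolding mem_left_ideal using lin_X[of 1] by (intro bexI[of _ "[:0, 1:]"]) (auto simp: pcompose_pCons)

text \<open>Two remainders differ by an element of the left ideal of degree below
  \<open>degree f\<close>, hence by 0, which justifies \<open>THE\<close>. The quotient is hidden in
  ideal membership, the form used for congruences from here on.\<close>

lemma rrem:
  assumes "f \<in> lin" "f \<noteq> 0" "p \<in> lin"
  shows "rrem q p f \<in> lin" "degree (rrem q p f) < degree f" "p - rrem q p f \<in> left_ideal q f"
proof -
  define P where "P r \<longleftrightarrow> r \<in> lin \<and> (r = 0 \<or> qdeg q r < qdeg q f) \<and>
      (\<exists>g\<in>lin. p = g \<circ>\<^sub>p f + r)" for r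
  have P: "P r \<longleftrightarrow> r \<in> lin \<and> degree r < degree f \<and> p - r \<in> left_ideal q f" for r
    unfolding mem_left_ideal diff_eq_eq P_def
    by (rule conj_cong[OF refl]) (simp only: lin_degree_less_iff[OF _ assms(1,2)])
  obtain g r where "r \<in> lin" "degree r < degree f" "g \<in> lin" "p = g \<circ>\<^sub>p f + r"
    using right_division[OF assms] by blast
  then have "P r"
    unfolding P mem_left_ideal by auto
  moreover have "r' = r" if r': "P r'" for r'
  proof -
    have "(p - r) - (p - r') \<in> left_ideal q f"
      using r' \<open>P r\<close> unfolding P by (blast intro: left_ideal_diff)
    then have "r' - r \<in> left_ideal q f"
      by simp
    moreover have "degree (r' - r) < degree f"
      using r' \<open>P r\<close> unfolding P by (blast intro: degree_diff_less)
    ultimately have "r' - r = 0"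
      by (rule left_ideal_degree_less[OF assms(1,2)])
    then show ?thesis
      by simp
  qed
  ultimately have "P (THE r. P r)"
    by (rule theI)
  then have "P (rrem q p f)"
    unfolding rrem_def P_def .
  then show "rrem q p f \<in> lin" "degree (rrem q p f) < degree f" "p - rrem q p f \<in> left_ideal q f"
    unfolding P by auto
qed

text \<open>A nonzero element of least degree generates, since remainders stay in \<open>J\<close>.
  Applied to intersections it gives least common multiples, applied to sums it gives Bezout
  relations.\<close>

lemma left_ideal_principal:
  assumes "J \<subseteq> lin" "0 \<in> J" and diff: "\<And>x y. x \<in> J \<Longrightarrow> y \<in> J \<Longrightarrow> x - y \<in> J"
    and comp: "\<And>g x. g \<in> lin \<Longrightarrow> x \<in> J \<Longrightarrow> g \<circ>\<^sub>p x \<in> J"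
  shows "\<exists>b\<in>lin. left_ideal q b = J"
proof (cases "J = {0}")
  case True
  then show ?thesis
    using lin_0 left_ideal_0[of 0]
    by (intro bexI[of _ 0]) (auto simp: mem_left_ideal pcompose_zero_right)
next
  case False
  with assms(2) obtain x where "x \<in> J \<and> x \<noteq> 0"
    by blast
  then obtain b where "b \<in> J \<and> b \<noteq> 0" and min: "\<And>x. x \<in> J \<Longrightarrow> x \<noteq> 0 \<Longrightarrow> degree b \<le> degree x"
    using ex_has_least_nat[of "\<lambda>x. x \<in> J \<and> x \<noteq> 0" x degree] by blast
  then have b: "b \<in> J" "b \<noteq> 0"
    by auto
  have "left_ideal q b \<subseteq> J"
    using b comp by (auto simp: left_ideal_def)
  moreover have "p \<in> left_ideal q b" if "p \<in> J" for p
  proof -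
    have pb: "b \<in> lin" "p \<in> lin"
      using assms(1) b that by auto
    note rr = rrem[OF pb(1) b(2) pb(2)]
    have "p - (p - rrem q p b) \<in> J"
      using calculation rr that by (blast intro: diff)
    then have "rrem q p b \<in> J"
      by simp
    then have "rrem q p b = 0"
      using min rr(2) by fastforce
    then show ?thesis
      using rr(3) by simp
  qed
  ultimately show ?thesis
    using b assms(1) by blast
qed

lemma is_lclm_lclm:
  assumes "\<And>i. i \<in> I \<Longrightarrow> f i \<in> lin"
  shows "is_lclm q I f (lclm q I f)"
proof -
  have "\<exists>b\<in>lin. left_ideal q b = lin \<inter> (\<Inter>i\<in>I. left_ideal q (f i))"
    by (rule left_ideal_principal)
      (auto intro: lin_0 lin_diff lin_pcompose left_ideal_0 left_ideal_diff left_ideal_pcompose)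
  then show ?thesis
    unfolding lclm_def is_lclm_def by (metis (mono_tags, lifting) someI_ex)
qed

text \<open>The generator of the sum \<open>J\<close> of the two left ideals right-divides both
  polynomials, hence the common divisor \<open>[:0, c:]\<close>. So \<open>J\<close> contains this
  scalar multiple of \<open>X\<close>, and then \<open>X\<close> itself.\<close>

lemma bezout:
  assumes "f \<in> lin" "b \<in> lin" "rcoprime q f b"
  shows "\<exists>S1\<in>lin. \<exists>S2\<in>lin. S1 \<circ>\<^sub>p b + S2 \<circ>\<^sub>p f = [:0, 1:]"
proof -
  obtain c where c: "c \<noteq> 0" and gcrd: "is_gcrd q [:0, c:] f b"
    using assms(3) by (auto simp: rcoprime_def)
  define J where "J = {u \<circ>\<^sub>p b + v \<circ>\<^sub>p f | u v. u \<in> lin \<and> v \<in> lin}"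
  have comp: "g \<circ>\<^sub>p x \<in> J" if gx: "g \<in> lin" "x \<in> J" for g x
  proof -
    obtain u v where uv: "u \<in> lin" "v \<in> lin" "x = u \<circ>\<^sub>p b + v \<circ>\<^sub>p f"
      using gx by (auto simp: J_def)
    then have "g \<circ>\<^sub>p x = (g \<circ>\<^sub>p u) \<circ>\<^sub>p b + (g \<circ>\<^sub>p v) \<circ>\<^sub>p f"
      using gx by (simp add: pcompose_add_right pcompose_assoc)
    then show ?thesis
      using uv gx lin_pcompose unfolding J_def by blast
  qed
  have X: "[:0, 1:] \<circ>\<^sub>p x = x" for x :: "'a poly"
    by (simp add: pcompose_pCons)
  have "\<exists>d\<in>lin. left_ideal q d = J"
  proof (rule left_ideal_principal)
    show "J \<subseteq> lin"
      using assms by (auto simp: J_def intro!: lin_add lin_pcompose)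
    have "0 = 0 \<circ>\<^sub>p b + 0 \<circ>\<^sub>p f"
      by simp
    then show "0 \<in> J"
      using lin_0 unfolding J_def by blast
    show "x - y \<in> J" if xy: "x \<in> J" "y \<in> J" for x y
    proof -
      obtain u v u' v' where uv: "u \<in> lin" "v \<in> lin" "x = u \<circ>\<^sub>p b + v \<circ>\<^sub>p f"
        "u' \<in> lin" "v' \<in> lin" "y = u' \<circ>\<^sub>p b + v' \<circ>\<^sub>p f"
        using xy by (auto simp: J_def)
      then have "x - y = (u - u') \<circ>\<^sub>p b + (v - v') \<circ>\<^sub>p f"
        by (simp add: pcompose_diff)
      then show ?thesis
        using uv lin_diff unfolding J_def by blast
    qed
  qed (use comp in auto)
  then obtain d where d: "d \<in> lin" "left_ideal q d = J"
    by blast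
  have "b = [:0, 1:] \<circ>\<^sub>p b + 0 \<circ>\<^sub>p f" "f = 0 \<circ>\<^sub>p b + [:0, 1:] \<circ>\<^sub>p f"
    by (simp_all only: X pcompose_0 add_0 add_0_right)
  then have "b \<in> J" "f \<in> J"
    using lin_0 lin_X unfolding J_def by blast+
  then have "rdivides q d b" "rdivides q d f"
    using d by (auto simp: rdivides_def mem_left_ideal[symmetric])
  then have "rdivides q d [:0, c:]"
    using gcrd d by (auto simp: is_gcrd_def)
  then have "[:0, c:] \<in> J"
    using d by (auto simp: rdivides_def mem_left_ideal[symmetric])
  then have "[:0, inverse c:] \<circ>\<^sub>p [:0, c:] \<in> J"
    by (rule comp[OF lin_X])
  then have "[:0, 1:] \<in> J"
    using c by (simp add: pcompose_pCons)
  then obtain u v where "u \<in> lin" "v \<in> lin" "[:0, 1:] = u \<circ>\<^sub>p b + v \<circ>\<^sub>p f"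
    unfolding J_def by blast
  then show ?thesis
    by (intro bexI[of _ u] bexI[of _ v]) simp_all
qed

section \<open>Counting, and the degree of the least common multiple\<close>

lemma card_lin_degree_less:
  assumes "finite (UNIV :: 'a set)"
  shows "card {p \<in> lin. degree p < q ^ N} = CARD('a) ^ N"
proof -
  let ?S = "\<lambda>e. \<Sum>j<N. monom (e j :: 'a) (q ^ j)"
  have inj: "inj_on ?S ({..<N} \<rightarrow>\<^sub>E UNIV)"
  proof (rule inj_onI)
    fix e e' :: "nat \<Rightarrow> 'a"
    assume e: "e \<in> {..<N} \<rightarrow>\<^sub>E UNIV" "e' \<in> {..<N} \<rightarrow>\<^sub>E UNIV" and eq: "?S e = ?S e'"
    have "e j = e' j" if "j < N" for j
      using arg_cong[OF eq, of "\<lambda>p. coeff p (q ^ j)"] that by (simp only: coeff_sum_monom_power_q if_True)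
    then show "e = e'"
      using e by (intro PiE_ext) auto
  qed
  have "p \<in> ?S ` ({..<N} \<rightarrow>\<^sub>E UNIV)" if "p \<in> lin" "degree p < q ^ N" for p
  proof
    show "p = ?S (restrict (\<lambda>j. coeff p (q ^ j)) {..<N})"
      by (subst lin_expand[OF that]) (rule sum.cong, auto)
  qed (rule restrict_PiE_iff[THEN iffD2], simp)
  moreover have "?S e \<in> lin" for e
    by (intro lin_sum lin_monom)
  ultimately have "{p \<in> lin. degree p < q ^ N} = ?S ` ({..<N} \<rightarrow>\<^sub>E UNIV)"
    using degree_sum_monom_power_q by blast
  then show ?thesis
    using inj by (simp add: card_image card_funcsetE)
qed

text \<open>
  Pigeonhole: with \<open>Q\<close> the size of the field and \<open>n\<close> the sum of the \<open>q\<close>-degrees, there are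
  \<open>Q\<^sup>n\<^sup>+\<^sup>1\<close> candidates but only \<open>Q\<^sup>n\<close> families of remainders.
\<close>

lemma common_left_multiple:
  assumes "finite (UNIV :: 'a set)" "finite I"
    and f: "\<And>i. i \<in> I \<Longrightarrow> f i \<in> lin" "\<And>i. i \<in> I \<Longrightarrow> f i \<noteq> 0"
  shows "\<exists>p\<in>lin. p \<noteq> 0 \<and> degree p \<le> q ^ (\<Sum>i\<in>I. qdeg q (f i)) \<and> (\<forall>i\<in>I. p \<in> left_ideal q (f i))"
proof -
  define n where "n = (\<Sum>i\<in>I. qdeg q (f i))"
  define A where "A N = {p \<in> lin. degree p < q ^ N}" for N
  define R where "R p = (\<lambda>i\<in>I. rrem q p (f i))" for p
  have cA: "card (A N) = CARD('a) ^ N" for N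
    unfolding A_def by (rule card_lin_degree_less[OF assms(1)])
  have Q: "CARD('a) > 1"
    using card_mono[OF assms(1), of "{0, 1}"] by simp
  have finA: "finite (A N)" for N
    using cA[of N] Q by (intro card_ge_0_finite) simp
  have deg: "degree (f i) = q ^ qdeg q (f i)" if "i \<in> I" for i
    using degree_lin f that by blast
  have "R ` A (Suc n) \<subseteq> (\<Pi>\<^sub>E i\<in>I. A (qdeg q (f i)))"
    using rrem(1,2)[OF f] by (force simp: R_def A_def simp flip: deg)
  then have "card (R ` A (Suc n)) \<le> card (\<Pi>\<^sub>E i\<in>I. A (qdeg q (f i)))"
    using assms(2) finA by (intro card_mono finite_PiE) auto
  also have "\<dots> = CARD('a) ^ n"
    using assms(2) by (simp add: card_PiE cA n_def power_sum)
  also have "\<dots> < card (A (Suc n))"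
    using Q by (simp add: cA)
  finally have "\<not> inj_on R (A (Suc n))"
    by (rule pigeonhole)
  then obtain p p' where p: "p \<in> A (Suc n)" "p' \<in> A (Suc n)" "R p = R p'" "p \<noteq> p'"
    unfolding inj_on_def by blast
  have lin: "p - p' \<in> lin" "p \<in> lin" "p' \<in> lin" and less: "degree (p - p') < q ^ Suc n"
    using p(1,2) unfolding A_def by (auto intro: lin_diff degree_diff_less)
  have "degree (p - p') = q ^ qdeg q (p - p')"
    using lin p(4) by (intro degree_lin) auto
  \<comment> \<open>The degree is a power of \<open>q\<close>, so being below
    \<open>q ^ Suc n\<close> it is at most \<open>q ^ n\<close>.\<close>
  then have "degree (p - p') \<le> q ^ n"
    using less power_strict_increasing_iff[OF q_gt_1] power_increasing_iff[OF q_gt_1]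
    by (simp only: less_Suc_eq_le)
  moreover have "p - p' \<in> left_ideal q (f i)" if i: "i \<in> I" for i
  proof -
    have "rrem q p (f i) = rrem q p' (f i)"
      using fun_cong[OF p(3), of i] i by (simp add: R_def)
    moreover have "(p - rrem q p (f i)) - (p' - rrem q p' (f i)) \<in> left_ideal q (f i)"
      using rrem(3)[OF f(1)[OF i] f(2)[OF i]] lin by (blast intro: left_ideal_diff)
    ultimately show ?thesis
      by simp
  qed
  ultimately show ?thesis
    using lin p(4) unfolding n_def by (intro bexI[of _ "p - p'"]) auto
qed

text \<open>The common left multiple just found is a left multiple of \<open>lclm q I f\<close>;
  being nonzero, it forces the latter to be nonzero and of no larger degree.\<close>

lemma lclm_nonzero_degree:
  assumes "finite (UNIV :: 'a set)" "finite I"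
    and f: "\<And>i. i \<in> I \<Longrightarrow> f i \<in> lin" "\<And>i. i \<in> I \<Longrightarrow> f i \<noteq> 0"
  shows "lclm q I f \<noteq> 0" "degree (lclm q I f) \<le> q ^ (\<Sum>i\<in>I. qdeg q (f i))"
proof -
  obtain p where p: "p \<in> lin" "p \<noteq> 0" "degree p \<le> q ^ (\<Sum>i\<in>I. qdeg q (f i))"
    "\<forall>i\<in>I. p \<in> left_ideal q (f i)"
    using common_left_multiple[of I f] assms by blast
  then have "p \<in> left_ideal q (lclm q I f)"
    using is_lclm_lclm[of I f] f(1) by (simp add: is_lclm_def)
  then obtain g where g: "g \<in> lin" "p = g \<circ>\<^sub>p lclm q I f"
    by (auto simp: mem_left_ideal)
  then show "lclm q I f \<noteq> 0"
    using p pcompose_zero_right by auto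
  have "g \<noteq> 0"
    using g p by auto
  then have "degree g > 0"
    using g degree_lin_pos by blast
  then have "degree (lclm q I f) \<le> degree p"
    using g(2) by (simp add: degree_pcompose)
  then show "degree (lclm q I f) \<le> q ^ (\<Sum>i\<in>I. qdeg q (f i))"
    using p(3) by simp
qed

section \<open>The lifting: congruences and injectivity\<close>

context
  fixes s :: nat and f :: "nat \<Rightarrow> 'a poly"
  assumes fin: "finite (UNIV :: 'a set)"
    and f_lin: "\<And>i. i \<in> {1..s} \<Longrightarrow> f i \<in> lin"
    and f_nonzero: "\<And>i. i \<in> {1..s} \<Longrightarrow> f i \<noteq> 0"
    and f_coprime: "\<And>i. i \<in> {1..s} \<Longrightarrow> rcoprime q (f i) (cofactor q s f i)"
begin

lemma cofactor_lin: "cofactor q s f i \<in> lin"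
  using is_lclm_lclm[of "{1..s} - {i}" f] f_lin by (auto simp: cofactor_def is_lclm_def)

lemma cofactor_left_ideal:
  assumes "i \<in> {1..s}" "j \<in> {1..s}" "i \<noteq> j"
  shows "cofactor q s f i \<in> left_ideal q (f j)"
proof -
  have "left_ideal q (cofactor q s f i) = lin \<inter> (\<Inter>j\<in>{1..s} - {i}. left_ideal q (f j))"
    using is_lclm_lclm[of "{1..s} - {i}" f] f_lin by (auto simp: cofactor_def is_lclm_def)
  then show ?thesis
    using left_ideal_self[of "cofactor q s f i"] assms by blast
qed

lemma bezout_coeff:
  assumes "i \<in> {1..s}"
  shows "bezout_coeff q (cofactor q s f i) (f i) \<in> lin"
    and "[:0, 1:] - bezout_coeff q (cofactor q s f i) (f i) \<circ>\<^sub>p cofactor q s f i \<in> left_ideal q (f i)"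
proof -
  define P where "P S1 \<longleftrightarrow> S1 \<in> lin \<and>
    (\<exists>S2\<in>lin. S1 \<circ>\<^sub>p cofactor q s f i + S2 \<circ>\<^sub>p f i = [:0, 1:])" for S1
  have "\<exists>S1. P S1"
    unfolding P_def using bezout[OF f_lin[OF assms] cofactor_lin f_coprime[OF assms]] by blast
  then have P: "P (bezout_coeff q (cofactor q s f i) (f i))"
    unfolding bezout_coeff_def P_def by (rule someI_ex)
  then show "bezout_coeff q (cofactor q s f i) (f i) \<in> lin"
    unfolding P_def by blast
  obtain S2 where S2: "S2 \<in> lin" "bezout_coeff q (cofactor q s f i) (f i) \<circ>\<^sub>p cofactor q s f i + S2 \<circ>\<^sub>p f i = [:0, 1:]"
    using P unfolding P_def by blast
  then have "[:0, 1:] - bezout_coeff q (cofactor q s f i) (f i) \<circ>\<^sub>p cofactor q s f i = S2 \<circ>\<^sub>p f i"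
    by (metis add_diff_cancel_left')
  with S2(1) show "[:0, 1:] - bezout_coeff q (cofactor q s f i) (f i) \<circ>\<^sub>p cofactor q s f i \<in> left_ideal q (f i)"
    unfolding mem_left_ideal by blast
qed

text \<open>The lift before reduction modulo the least common multiple.\<close>

definition lift_sum :: "(nat \<Rightarrow> 'a poly) \<Rightarrow> 'a poly" where
  "lift_sum p = (\<Sum>i\<in>{1..s}. p i \<circ>\<^sub>p bezout_coeff q (cofactor q s f i) (f i) \<circ>\<^sub>p cofactor q s f i)"

text \<open>Modulo \<open>f j\<close> the terms with \<open>i \<noteq> j\<close> vanish because
  their cofactors are left multiples of \<open>f j\<close>; in the term for \<open>j\<close> the
  Bezout product is congruent to \<open>X\<close>.\<close>

lemma lift_sum_congruent:
  assumes p: "\<And>i. i \<in> {1..s} \<Longrightarrow> p i \<in> lin" and j: "j \<in> {1..s}"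
  shows "p j - lift_sum p \<in> left_ideal q (f j)"
proof -
  let ?S = "\<lambda>i. bezout_coeff q (cofactor q s f i) (f i)"
  let ?b = "\<lambda>i. cofactor q s f i"
  have "lift_sum p = p j \<circ>\<^sub>p ?S j \<circ>\<^sub>p ?b j + (\<Sum>i\<in>{1..s} - {j}. p i \<circ>\<^sub>p ?S i \<circ>\<^sub>p ?b i)"
    unfolding lift_sum_def using j by (subst sum.remove[of _ j]) auto
  moreover have "p j - p j \<circ>\<^sub>p ?S j \<circ>\<^sub>p ?b j = p j \<circ>\<^sub>p ([:0, 1:] - ?S j \<circ>\<^sub>p ?b j)"
    unfolding pcompose_diff_right[OF p[OF j]] by (simp add: pcompose_assoc)
  ultimately have "p j - lift_sum p =
      p j \<circ>\<^sub>p ([:0, 1:] - ?S j \<circ>\<^sub>p ?b j) - (\<Sum>i\<in>{1..s} - {j}. (p i \<circ>\<^sub>p ?S i) \<circ>\<^sub>p ?b i)"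
    by (simp add: algebra_simps)
  moreover have "(\<Sum>i\<in>{1..s} - {j}. (p i \<circ>\<^sub>p ?S i) \<circ>\<^sub>p ?b i) \<in> left_ideal q (f j)"
    using p j by (intro left_ideal_sum left_ideal_pcompose lin_pcompose cofactor_left_ideal bezout_coeff) auto
  ultimately show ?thesis
    using p j bezout_coeff(2)[OF j] by (auto intro!: left_ideal_diff left_ideal_pcompose)
qed

lemma lift_sum_lin:
  "(\<And>i. i \<in> {1..s} \<Longrightarrow> p i \<in> lin) \<Longrightarrow> lift_sum p \<in> lin"
  unfolding lift_sum_def by (intro lin_sum lin_pcompose bezout_coeff cofactor_lin) auto

lemma lclm_lin: "lclm q {1..s} f \<in> lin"
  using is_lclm_lclm[of "{1..s}" f] f_lin by (auto simp: is_lclm_def)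

lemma crt_lift_rrem: "crt_lift q s f p = rrem q (lift_sum p) (lclm q {1..s} f)"
  by (simp add: crt_lift_def lift_sum_def)

lemma lclm_nonzero:
  "lclm q {1..s} f \<noteq> 0" "degree (lclm q {1..s} f) \<le> q ^ (\<Sum>i\<in>{1..s}. qdeg q (f i))"
  using f_lin f_nonzero by (intro lclm_nonzero_degree[OF fin finite_atLeastAtMost]; blast)+

lemma crt_lift_lin:
  assumes "\<And>i. i \<in> {1..s} \<Longrightarrow> p i \<in> lin"
  shows "crt_lift q s f p \<in> lin" "degree (crt_lift q s f p) < q ^ (\<Sum>i\<in>{1..s}. qdeg q (f i))"
proof -
  note r = rrem(1,2)[OF lclm_lin lclm_nonzero(1) lift_sum_lin[OF assms]]
  show "crt_lift q s f p \<in> lin"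
    unfolding crt_lift_rrem by (rule r(1))
  show "degree (crt_lift q s f p) < q ^ (\<Sum>i\<in>{1..s}. qdeg q (f i))"
    unfolding crt_lift_rrem using less_le_trans[OF r(2) lclm_nonzero(2)] .
qed

text \<open>The reduction changes the sum by a left multiple of the least common multiple, hence of
  every \<open>f j\<close>.\<close>

lemma crt_lift_congruent:
  assumes p: "\<And>i. i \<in> {1..s} \<Longrightarrow> p i \<in> lin" and j: "j \<in> {1..s}"
  shows "p j - crt_lift q s f p \<in> left_ideal q (f j)"
proof -
  have "left_ideal q (lclm q {1..s} f) \<subseteq> left_ideal q (f j)"
    using is_lclm_lclm[of "{1..s}" f] f_lin j by (auto simp: is_lclm_def)
  then have "lift_sum p - crt_lift q s f p \<in> left_ideal q (f j)"
    using rrem(3)[OF lclm_lin lclm_nonzero(1) lift_sum_lin[of p]] p unfolding crt_lift_rrem by auto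
  then have "(p j - lift_sum p) + (lift_sum p - crt_lift q s f p) \<in> left_ideal q (f j)"
    using lift_sum_congruent[of p j] p j by (intro left_ideal_add) auto
  then show ?thesis
    by simp
qed

text \<open>Both components are congruent to the same lift modulo \<open>f j\<close> and have
  smaller degree than \<open>f j\<close>, so their difference is 0.\<close>

lemma crt_lift_inj:
  assumes p: "\<And>i. i \<in> {1..s} \<Longrightarrow> p i \<in> lin" "\<And>i. i \<in> {1..s} \<Longrightarrow> degree (p i) < degree (f i)"
    and p': "\<And>i. i \<in> {1..s} \<Longrightarrow> p' i \<in> lin" "\<And>i. i \<in> {1..s} \<Longrightarrow> degree (p' i) < degree (f i)"
    and eq: "crt_lift q s f p = crt_lift q s f p'" and j: "j \<in> {1..s}"
  shows "p j = p' j"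
proof -
  have "(p j - crt_lift q s f p) - (p' j - crt_lift q s f p') \<in> left_ideal q (f j)"
    using p p' j by (intro left_ideal_diff crt_lift_congruent) auto
  then have "p j - p' j \<in> left_ideal q (f j)"
    using eq by simp
  then have "p j - p' j = 0"
    using p p' j f_lin f_nonzero by (intro left_ideal_degree_less[of "f j"] degree_diff_less) auto
  then show ?thesis
    by simp
qed

end

section \<open>From error vectors to coefficient vectors\<close>

lemma vec_blocks_lin: "vec_blocks q d e i \<in> lin" "degree (vec_blocks q d (e :: nat \<Rightarrow> 'a) i) < q ^ d i"
  unfolding vec_blocks_def by (intro lin_sum lin_monom degree_sum_monom_power_q)+

lemma vec_blocks_inj:
  assumes "\<And>i. i \<in> {1..s} \<Longrightarrow> vec_blocks q d e i = vec_blocks q d (e' :: nat \<Rightarrow> 'a) i"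
    and "x < (\<Sum>i\<in>{1..s}. d i)"
  shows "e x = e' x"
  using assms
proof (induction s)
  case (Suc s)
  show ?case
  proof (cases "x < (\<Sum>i\<in>{1..s}. d i)")
    case False
    \<comment> \<open>The offset of \<open>x\<close> inside the last block.\<close>
    define j where "j = x - (\<Sum>i\<in>{1..<Suc s}. d i)"
    have j: "j < d (Suc s)" "(\<Sum>i\<in>{1..<Suc s}. d i) + j = x"
      using False Suc.prems(2) by (auto simp: j_def atLeastLessThanSuc_atLeastAtMost)
    have "coeff (vec_blocks q d e (Suc s)) (q ^ j) = coeff (vec_blocks q d e' (Suc s)) (q ^ j)"
      using Suc.prems(1)[of "Suc s"] by simp
    then show ?thesis
      unfolding vec_blocks_def coeff_sum_monom_power_q using j by simp
  qed (use Suc in auto)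
qed simp

text \<open>
  Injectivity suffices: the coefficient vector of the lift again has length \<open>n\<close>, because the
  left least common multiple has \<open>q\<close>-degree at most \<open>n\<close>.
\<close>

lemma bij_betw_crt_lift:
  fixes f :: "nat \<Rightarrow> 'a poly"
  assumes "finite (UNIV :: 'a set)"
    and "\<And>i. i \<in> {1..s} \<Longrightarrow> f i \<in> lin" "\<And>i. i \<in> {1..s} \<Longrightarrow> f i \<noteq> 0"
    and "\<And>i. i \<in> {1..s} \<Longrightarrow> rcoprime q (f i) (cofactor q s f i)"
    and d: "\<And>i. i \<in> {1..s} \<Longrightarrow> qdeg q (f i) = d i" and n: "n = (\<Sum>i\<in>{1..s}. d i)"
  shows "bij_betw (\<lambda>e. \<lambda>j\<in>{..<n}. coeff (crt_lift q s f (vec_blocks q d e)) (q ^ j))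
           ({..<n} \<rightarrow>\<^sub>E UNIV) ({..<n} \<rightarrow>\<^sub>E UNIV)" (is "bij_betw ?G ?D ?D")
    and "crt_lift q s f (vec_blocks q d e) \<in> lin"
    and "degree (crt_lift q s f (vec_blocks q d e)) < q ^ n"
proof -
  note blocks = vec_blocks_lin
  have nd: "n = (\<Sum>i\<in>{1..s}. qdeg q (f i))"
    using d n by simp
  note L = crt_lift_lin[OF assms(1-4) blocks(1), folded nd]
  show "crt_lift q s f (vec_blocks q d e) \<in> lin"
    and "degree (crt_lift q s f (vec_blocks q d e)) < q ^ n"
    using L by auto
  have "inj_on ?G ?D"
  proof (rule inj_onI)
    fix e e'
    assume e: "e \<in> ?D" "e' \<in> ?D" and eq: "?G e = ?G e'"
    let ?p = "\<lambda>e. crt_lift q s f (vec_blocks q d e)"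
    have c: "coeff (?p e) (q ^ j) = coeff (?p e') (q ^ j)" if "j < n" for j
      using fun_cong[OF eq, of j] that by simp
    have "?p e = (\<Sum>j<n. monom (coeff (?p e) (q ^ j)) (q ^ j))"
      by (rule lin_expand[OF L])
    also have "\<dots> = (\<Sum>j<n. monom (coeff (?p e') (q ^ j)) (q ^ j))"
      by (rule sum.cong) (use c in auto)
    also have "\<dots> = ?p e'"
      by (rule lin_expand[OF L, symmetric])
    finally have "?p e = ?p e'" .
    then have "vec_blocks q d e i = vec_blocks q d e' i" if "i \<in> {1..s}" for i
      using blocks d degree_lin assms(2,3) that
      by (intro crt_lift_inj[OF assms(1-4), of "vec_blocks q d e" "vec_blocks q d e'" i]) auto
    then have "e x = e' x" if "x < n" for x
      using vec_blocks_inj[of s d e e' x] that n by blast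
    then show "e = e'"
      using e by (intro PiE_ext) auto
  qed
  moreover have "?G ` ?D = ?D"
    using assms(1) by (intro endo_inj_surj[OF _ _ \<open>inj_on ?G ?D\<close>] finite_PiE) auto
  ultimately show "bij_betw ?G ?D ?D"
    by (rule bij_betw_imageI)
qed

end

lemma linearized_ring_finite_field:
  assumes "primepow q" "CARD('a::finite_field) = q ^ m"
  shows "linearized_ring TYPE('a) q"
proof
  show "q > 1"
    using primepow_gt_Suc_0[OF assms(1)] by simp
  obtain p k where p: "prime p" "q = p ^ k"
    using assms(1) unfolding primepow_def by blast
  have prime: "prime CHAR('a)"
    using finite_imp_CHAR_pos[where ?'a = 'a] by (intro prime_CHAR_semidom) auto
  \<comment> \<open>Translation by 1 permutes the field, so the number of elements is 0 in it. This
    forces the characteristic to be the prime of which \<open>q\<close> is a power.\<close>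
  have "(\<Sum>x\<in>UNIV. x + 1) = (\<Sum>x\<in>UNIV. x :: 'a)"
    by (rule sum.reindex_bij_witness[of _ "\<lambda>x. x - 1" "\<lambda>x. x + 1"]) auto
  then have "of_nat CARD('a) = (0 :: 'a)"
    by (simp add: sum.distrib)
  then have "CHAR('a) dvd p ^ (k * m)"
    unfolding of_nat_eq_0_iff_char_dvd assms(2) p(2) power_mult .
  with prime have "CHAR('a) dvd p"
    by (rule prime_dvd_power)
  with prime p(1) have "CHAR('a) = p"
    by (rule primes_dvd_imp_eq)
  then show "(x + y) ^ q = x ^ q + y ^ q" for x y :: "'a poly"
    using p prime by (intro freshmans_dream'[of q k]) simp_all
qed

section \<open>Supports and conditional probabilities\<close>

context linearized_ring
begin

context
  fixes \<iota> :: "'k::field \<Rightarrow> 'a"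
  assumes embedding: "field_embedding \<iota>"
begin

text \<open>The support is spanned by all coefficients, among them the zeros at exponents that are
  not powers of \<open>q\<close>; these do not change the span.\<close>

lemma support_eqI:
  assumes "\<And>i. coeff p i \<noteq> 0 \<Longrightarrow> coeff p i \<in> X" "X \<subseteq> range (coeff p)"
  shows "support \<iota> p = module.span (scale_by \<iota>) X"
proof -
  interpret vector_space "scale_by \<iota>"
    by (rule vector_space_scale_by[OF embedding])
  have "coeff p i \<in> span X" for i
    using assms(1)[of i] span_base span_zero by (cases "coeff p i = 0") simp_all
  then have "range (coeff p) \<subseteq> span X"
    by blast
  moreover have "X \<subseteq> span (range (coeff p))"
    using assms(2) span_superset by (rule subset_trans)
  ultimately show ?thesis
    unfolding support_def span_eq by blast
qed

lemma support_lin: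
  assumes "p \<in> lin" "degree p < q ^ n"
  shows "support \<iota> p = module.span (scale_by \<iota>) ((\<lambda>j. coeff p (q ^ j)) ` {..<n})"
proof (rule support_eqI)
  fix i
  assume i: "coeff p i \<noteq> 0"
  then obtain j where j: "i = q ^ j"
    using assms(1) unfolding linearized_def by blast
  have "q ^ j < q ^ n"
    using le_degree[OF i] assms(2) j by simp
  then have "j < n"
    using power_strict_increasing_iff[OF q_gt_1] by blast
  then show "coeff p i \<in> (\<lambda>j. coeff p (q ^ j)) ` {..<n}"
    using j by blast
qed auto

lemma support_upper_part:
  "support \<iota> (upper_part q t n p) = module.span (scale_by \<iota>) ((\<lambda>j. coeff p (q ^ j)) ` {t..<n})"
proof (rule support_eqI)
  have c: "coeff (upper_part q t n p) (q ^ j) = coeff p (q ^ j)" if "j \<in> {t..<n}" for j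
  proof -
    have "coeff (upper_part q t n p) (q ^ j) = (\<Sum>i\<in>{t..<n}. if i = j then coeff p (q ^ i) else 0)"
      unfolding upper_part_def coeff_sum coeff_monom using q_gt_1 by (simp add: power_inject_exp)
    then show ?thesis
      using that by simp
  qed
  show "(\<lambda>j. coeff p (q ^ j)) ` {t..<n} \<subseteq> range (coeff (upper_part q t n p))"
    by (rule image_subsetI) (simp only: c[symmetric], rule rangeI)
  fix i
  assume i: "coeff (upper_part q t n p) i \<noteq> 0"
  then obtain j where "j \<in> {t..<n}" "coeff (monom (coeff p (q ^ j)) (q ^ j)) i \<noteq> 0"
    unfolding upper_part_def coeff_sum by (rule sum.not_neutral_contains_not_neutral)
  then have "i = q ^ j" "j \<in> {t..<n}"
    by (auto split: if_splits)
  then show "coeff (upper_part q t n p) i \<in> (\<lambda>j. coeff p (q ^ j)) ` {t..<n}"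
    using c[of j] by (intro image_eqI[of _ _ j]) simp_all
qed

end

end

lemma cond_prob_pmf_of_set:
  assumes "finite D" "D \<noteq> {}"
  shows "cond_prob (measure_pmf (pmf_of_set D)) P Q =
    real (card {e \<in> D. P e \<and> Q e}) / real (card {e \<in> D. Q e})"
  using assms by (simp add: cond_prob_def measure_pmf_of_set Int_def)

text \<open>This carries counts of error vectors over to counts of coefficient vectors, which
  expresses that the latter are again uniform.\<close>

lemma bij_betw_card_Collect:
  assumes "bij_betw g A B"
  shows "card {x \<in> A. P (g x)} = card {y \<in> B. P y}"
proof -
  have "{y \<in> B. P y} = g ` {x \<in> A. P (g x)}"
    using assms by (auto simp: bij_betw_def)
  moreover have "inj_on g {x \<in> A. P (g x)}"
    using assms by (auto simp: bij_betw_def intro: inj_on_subset)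
  ultimately show ?thesis
    by (simp add: card_image)
qed

theorem proposition26:
  fixes q m l s n k \<alpha> r :: nat
    and \<iota> :: "'k::finite_field \<Rightarrow> 'a::finite_field"
    and L :: "'a set"
    and f :: "nat \<Rightarrow> 'a poly"
    and d :: "nat \<Rightarrow> nat"
    and A :: "'a poly"
    and E :: "(nat \<Rightarrow> 'a) \<Rightarrow> 'a poly"
  assumes "primepow q" and "m > 0"
    and "CARD('k) = q" and "CARD('a) = q ^ m" and "field_embedding \<iota>"
    and "is_subfield L" and "card L = q ^ l"
    and "\<And>i. i \<in> {1..s} \<Longrightarrow> f i \<in> linearized q L \<and> f i \<noteq> 0 \<and> qdeg q (f i) = d i"
    and "n = (\<Sum>i\<in>{1..s}. d i)"
    and "\<And>i. i \<in> {1..s} \<Longrightarrow> rcoprime q (f i) (cofactor q s f i)"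
    and "0 < k" and "k < n"
    and "A \<in> linearized q UNIV" and "A \<noteq> 0" and "qdeg q A = \<alpha>" and "k + \<alpha> < n"
    and "r \<in> {1..min (m div l) ((n - \<alpha> - k) div l)}"
    and "\<And>e. E e = crt_lift q s f (vec_blocks q d e)"
  shows "\<P>(e in measure_pmf (pmf_of_set ({..<n} \<rightarrow>\<^sub>E (UNIV :: 'a set))).
            support \<iota> (upper_part q (k + \<alpha>) n (E e)) = support \<iota> (E e) \<bar>
            rank_weight \<iota> (E e) \<le> r * l)
         \<ge> real q ^ (l * r * (k + \<alpha>)) *
            (\<Prod>i<r * l. (real q ^ (n - (k + \<alpha>)) - real q ^ i) / (real q ^ n - real q ^ i))"
proof -
  define D where "D = {..<n} \<rightarrow>\<^sub>E (UNIV :: 'a set)"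
  define t where "t = k + \<alpha>"
  interpret linearized_ring q "TYPE('a)"
    by (rule linearized_ring_finite_field[OF assms(1,4)])
  obtain B where "finite_vector_space (scale_by \<iota>) B"
    using finite_vector_space_scale_by[OF assms(5)] .
  then interpret finite_vector_space "scale_by \<iota>" B .
  have f: "f i \<in> lin" "f i \<noteq> 0" "qdeg q (f i) = d i" if "i \<in> {1..s}" for i
    using assms(8)[OF that] by (auto simp: linearized_def)
  note lift = bij_betw_crt_lift[OF finite_vectors f(1,2) assms(10) f(3) assms(9), folded assms(18)]
  \<comment> \<open>\<open>G\<close> takes an error vector to the coefficient vector of its lift.
    Its values are extensional, so it maps \<open>D\<close> to itself.\<close>
  define G where "G e = (\<lambda>j\<in>{..<n}. coeff (E e) (q ^ j))" for e
  have bij: "bij_betw G D D"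
    using lift(1) unfolding G_def D_def .
  have image: "(\<lambda>j. coeff (E e) (q ^ j)) ` S = G e ` S" if "S \<subseteq> {..<n}" for e S
    using that by (intro image_cong) (auto simp: G_def)
  have support: "support \<iota> (E e) = span (G e ` {..<n})" for e
    using support_lin[OF assms(5) lift(2,3)] image by simp
  have upper: "support \<iota> (upper_part q t n (E e)) = span (G e ` {t..<n})" for e
  proof -
    have "{t..<n} \<subseteq> {..<n}"
      by auto
    then show ?thesis
      using support_upper_part[OF assms(5), of t n "E e"] image by simp
  qed
  define P where "P c \<longleftrightarrow> span (c ` {t..<n}) = span (c ` {..<n})" for c :: "nat \<Rightarrow> 'a"
  define W where "W c \<longleftrightarrow> dim (c ` {..<n}) \<le> r * l" for c :: "nat \<Rightarrow> 'a"
  have D: "finite D" "D \<noteq> {}"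
    by (auto simp: D_def PiE_eq_empty_iff intro: finite_tuples)
  \<comment> \<open>The second bound on \<open>r\<close> ensures that every rank considered fits
    into the \<open>n - t\<close> upper coefficients.\<close>
  have "r * l \<le> (n - \<alpha> - k) div l * l"
    using assms(17) by (intro mult_right_mono) auto
  also have "\<dots> \<le> n - t"
    by (simp add: t_def diff_diff_add add.commute)
  finally have R: "r * l \<le> n - t" .
  define \<rho> where "\<rho> = real q ^ (r * l * t) *
    (\<Prod>i<r * l. (real q ^ (n - t) - real q ^ i) / (real q ^ n - real q ^ i))"
  have le: "\<rho> * real (card {c \<in> D. W c}) \<le> real (card {c \<in> D. P c \<and> W c})"
    using card_span_eq_rank_le_ge[of t n "r * l"] R assms(3,16)
    by (simp add: \<rho>_def W_def P_def D_def t_def)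
  \<comment> \<open>The zero vector shows that the conditioning event is not empty, so its count may
    be divided by.\<close>
  define z :: "nat \<Rightarrow> 'a" where "z = (\<lambda>j\<in>{..<n}. 0)"
  have "z \<in> D" "z ` {..<n} \<subseteq> {0}"
    by (auto simp: z_def D_def)
  moreover from this(2) have "dim (z ` {..<n}) = 0"
    by (rule dim_eq_0[THEN iffD2])
  ultimately have "z \<in> {c \<in> D. W c}"
    by (simp add: W_def del: dim_eq_0)
  then have "card {c \<in> D. W c} > 0"
    using D(1) by (auto simp: card_gt_0_iff)
  then have "\<rho> \<le> real (card {c \<in> D. P c \<and> W c}) / real (card {c \<in> D. W c})"
    using le by (simp add: pos_le_divide_eq)
  also have "\<dots> = real (card {e \<in> D. P (G e) \<and> W (G e)}) / real (card {e \<in> D. W (G e)})"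
    using bij_betw_card_Collect[OF bij, of "\<lambda>c. P c \<and> W c"] bij_betw_card_Collect[OF bij, of W] by simp
  also have "\<dots> = cond_prob (measure_pmf (pmf_of_set D)) (\<lambda>e. P (G e)) (\<lambda>e. W (G e))"
    using cond_prob_pmf_of_set[OF D] by simp
  finally show ?thesis
    unfolding D_def[symmetric] t_def[symmetric] rank_weight_def upper support
    by (simp add: P_def W_def \<rho>_def dim_span mult.commute)
qed

end
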